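(* Let $N,M$ be positive integers, let $\mathcal A,\mathcal M\in\mathbb C^{N\times N}$ with $\mathcal A$ Hermitian positive semi-definite and $\mathcal M$ Hermitian positive definite, let $\mathcal B\in\mathbb C^{N\times M}$ satisfy $\mathcal A\mathcal M^{-1}\mathcal B=0$, let $\mathcal U\in\mathbb C^{M\times M}$ be Hermitian positive definite, let $\mathcal F\in\mathbb C^N$ and let $0\neq\mathcal G\in\operatorname{Im}\mathcal B^*\subset\mathbb C^M$. Suppose $\dim\mathbb C_0=0$, and let $\alpha_1,\alpha_2>0$ be real with $\alpha_1\neq\alpha_2$. Then the constrained system $$\mathcal A u+\mathcal B p=\mathcal F,\qquad \mathcal B^* u=\mathcal G\qquad (u\in\mathbb C^N,\ p\in\mathbb C^M)$$ has a solution $(u,p)$ whose component $u$ is unique. Moreover each of the equations $$(\mathcal A+\alpha_1\mathcal B\mathcal U\mathcal B^* )u_1=\mathcal F+\alpha_1\mathcal B\mathcal U\mathcal G,\qquad (\mathcal A+\alpha_2\mathcal B\mathcal U\mathcal B^* )u_2=\mathcal F+\alpha_2\mathcal B\mathcal U\mathcal G$$ has a unique solution $u_1,u_2\in\mathbb C^N$ respectively, and $$u=\frac{\alpha_1u_1-\alpha_2u_2}{\alpha_1-\alpha_2}.$$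
   Context: $X^*$ denotes the conjugate transpose of a matrix $X$. $\mathbb C_0:=\operatorname{Ker}\mathcal A\cap\operatorname{Ker}(\mathcal B\mathcal U\mathcal B^* )\subset\mathbb C^N$. *)

theory Defs
  imports "HOL-Analysis.Analysis"
begin

text \<open>A matrix of type \<open>complex ^ 'm ^ 'n\<close> has rows indexed by \<open>'n\<close> and columns indexed by \<open>'m\<close>.\<close>

definition adjoint_mat :: "complex ^ 'm ^ 'n \<Rightarrow> complex ^ 'n ^ 'm" where
  "adjoint_mat X = (\<chi> i j. cnj (X $ j $ i))"

definition hermitian_mat :: "complex ^ 'n ^ 'n \<Rightarrow> bool" where
  "hermitian_mat X \<longleftrightarrow> adjoint_mat X = X"

text \<open>The form \<open>x\<^sup>* X x\<close>; the library's inner product on \<open>complex ^ 'n\<close> is only its real version.\<close>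

definition quad_form :: "complex ^ 'n ^ 'n \<Rightarrow> complex ^ 'n \<Rightarrow> complex" where
  "quad_form X x = (\<Sum>i\<in>UNIV. cnj (x $ i) * (X *v x) $ i)"

text \<open>For Hermitian \<open>X\<close> the form takes real values only, so comparing its real part with \<open>0\<close>
  loses nothing.\<close>

definition hermitian_psd :: "complex ^ 'n ^ 'n \<Rightarrow> bool" where
  "hermitian_psd X \<longleftrightarrow> hermitian_mat X \<and> (\<forall>x. Re (quad_form X x) \<ge> 0)"

definition hermitian_pd :: "complex ^ 'n ^ 'n \<Rightarrow> bool" where
  "hermitian_pd X \<longleftrightarrow> hermitian_mat X \<and> (\<forall>x. x \<noteq> 0 \<longrightarrow> Re (quad_form X x) > 0)"

definition ker_mat :: "complex ^ 'm ^ 'n \<Rightarrow> (complex ^ 'm) set" where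
  "ker_mat X = {x. X *v x = 0}"

definition C0 :: "complex ^ 'n ^ 'n \<Rightarrow> complex ^ 'm ^ 'n \<Rightarrow> complex ^ 'm ^ 'm \<Rightarrow> (complex ^ 'n) set" where
  "C0 A B U = ker_mat A \<inter> ker_mat (B ** U ** adjoint_mat B)"

end

(* Write S = B U B*. The relation A M^{-1} B = 0 makes the ranges of A and B meet only in 0, so any
   equation between elements of Im A + Im B splits into an A-part and a B-part. Hence A + a S is
   injective for a > 0, and with F = (A + S) f and G = B* w the a-th augmented solution u_a
   satisfies A u_a = A f and a S u_a = S f + a S w. Subtracting the two instances shows that the
   extrapolated vector u satisfies A u = A f and S u = S w, and it solves the constrained system
   with multiplier p = U B* f. *)

theory Submission
  imports Defs
begin

text \<open>The complex sesquilinear form, conjugate-linear in the first argument, so that a matrix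
  crosses it as its adjoint.\<close>

definition cdot :: "complex ^ 'n \<Rightarrow> complex ^ 'n \<Rightarrow> complex" where
  "cdot x y = (\<Sum>i\<in>UNIV. cnj (x $ i) * y $ i)"

lemma quad_form_cdot: "quad_form X x = cdot x (X *v x)"
  by (simp add: quad_form_def cdot_def)

lemma cdot_zero_left [simp]: "cdot 0 y = 0"
  by (simp add: cdot_def)

lemma cdot_zero_right [simp]: "cdot x 0 = 0"
  by (simp add: cdot_def)

lemma cdot_mult_right: "cdot x (X *v y) = cdot (adjoint_mat X *v x) y"
proof -
  have "cdot x (X *v y) = (\<Sum>i\<in>UNIV. \<Sum>j\<in>UNIV. cnj (x $ i) * (X $ i $ j * y $ j))"
    by (simp add: cdot_def matrix_vector_mult_def sum_distrib_left)
  also have "\<dots> = (\<Sum>j\<in>UNIV. \<Sum>i\<in>UNIV. cnj (x $ i) * (X $ i $ j * y $ j))"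
    by (rule sum.swap)
  also have "\<dots> = cdot (adjoint_mat X *v x) y"
    by (simp add: cdot_def matrix_vector_mult_def adjoint_mat_def sum_distrib_left
        sum_distrib_right mult_ac)
  finally show ?thesis .
qed

lemma adjoint_mat_mult: "adjoint_mat (X ** Y) = adjoint_mat Y ** adjoint_mat X"
  by (simp add: adjoint_mat_def vec_eq_iff matrix_matrix_mult_def mult_ac)

lemma adjoint_mat_one [simp]: "adjoint_mat (mat 1) = mat 1"
  by (simp add: adjoint_mat_def vec_eq_iff mat_def)

lemma adjoint_mat_zero [simp]: "adjoint_mat 0 = 0"
  by (simp add: adjoint_mat_def vec_eq_iff)

lemma scaleR_matrix_vector_mult_complex:
  fixes X :: "complex ^ 'm ^ 'n"
  shows "(a *\<^sub>R X) *v x = a *\<^sub>R (X *v x)"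
  by (simp add: vec_eq_iff matrix_vector_mult_def scaleR_sum_right)

lemma matrix_vector_mult_scaleR_complex:
  fixes X :: "complex ^ 'm ^ 'n"
  shows "X *v (a *\<^sub>R x) = a *\<^sub>R (X *v x)"
  by (simp add: vec_eq_iff matrix_vector_mult_def scaleR_sum_right)

text \<open>A trivial kernel yields a left inverse, which for a square matrix is two-sided.\<close>

lemma square_matrix_bij_if_kernel_trivial:
  fixes X :: "complex ^ 'n ^ 'n"
  assumes "\<And>x. X *v x = 0 \<Longrightarrow> x = 0"
  shows "bij ((*v) X)"
proof -
  have "\<exists>Y. Y ** X = mat 1"
    unfolding matrix_left_invertible_ker using assms by auto
  then show ?thesis
    by (simp add: invertible_left_inverse flip: invertible_eq_bij)
qed

lemma hermitian_pd_kernel: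
  assumes "hermitian_pd X" and "cdot x (X *v x) = 0"
  shows "x = 0"
  using assms by (auto simp: hermitian_pd_def quad_form_cdot)

lemma hermitian_pd_matrix_inv:
  fixes X :: "complex ^ 'n ^ 'n"
  assumes "hermitian_pd X"
  shows "X ** matrix_inv X = mat 1" "adjoint_mat (matrix_inv X) = matrix_inv X"
proof -
  have "invertible X"
    unfolding invertible_eq_bij
    by (rule square_matrix_bij_if_kernel_trivial) (use hermitian_pd_kernel[OF assms] in auto)
  \<comment> \<open>\<open>matrix_inv\<close> is defined by choice, so invertibility is what makes
    it satisfy both inverse equations.\<close>
  then have "X ** matrix_inv X = mat 1 \<and> matrix_inv X ** X = mat 1"
    unfolding invertible_def matrix_inv_def by (rule someI_ex)
  then show r: "X ** matrix_inv X = mat 1" ..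
  have "adjoint_mat X = X"
    using assms by (simp add: hermitian_pd_def hermitian_mat_def)
  \<comment> \<open>Taking adjoints in \<open>X ** matrix_inv X = mat 1\<close> makes the adjoint of
    the inverse a left inverse of \<open>X\<close>; a left and a right inverse coincide.\<close>
  then have "adjoint_mat (matrix_inv X) ** X = mat 1"
    using adjoint_mat_mult[of X "matrix_inv X"] r by simp
  then show "adjoint_mat (matrix_inv X) = matrix_inv X"
    using r matrix_mul_assoc[of "adjoint_mat (matrix_inv X)" X "matrix_inv X"] by simp
qed

lemma kernel_congruence:
  fixes B :: "complex ^ 'm ^ 'n"
  assumes "hermitian_pd U" and "(B ** U ** adjoint_mat B) *v x = 0"
  shows "adjoint_mat B *v x = 0"
proof -
  have "cdot (adjoint_mat B *v x) (U *v (adjoint_mat B *v x)) = 0"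
    using assms(2) cdot_mult_right[of x B "U *v (adjoint_mat B *v x)"]
    by (simp add: matrix_vector_mul_assoc matrix_mul_assoc)
  then show ?thesis
    by (rule hermitian_pd_kernel[OF assms(1)])
qed

text \<open>Put z = M^{-1} A x, so that M z = A x = B y. Then B* z = (A M^{-1} B)* x = 0, hence z* M
  z = (B* z)* y = 0. Definiteness of \<open>M\<close> gives z = 0 and so A x = 0.\<close>

lemma ranges_meet_trivially:
  fixes A M :: "complex ^ 'n ^ 'n" and B :: "complex ^ 'm ^ 'n"
  assumes "hermitian_mat A" and M: "hermitian_pd M"
    and AMB: "A ** matrix_inv M ** B = 0" and eq: "A *v x = B *v y"
  shows "A *v x = 0"
proof -
  define z where "z = matrix_inv M *v (A *v x)"
  have Mz: "M *v z = A *v x"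
    by (simp add: z_def matrix_vector_mul_assoc matrix_mul_assoc hermitian_pd_matrix_inv[OF M])
  have "adjoint_mat B ** matrix_inv M ** A = adjoint_mat (A ** matrix_inv M ** B)"
    using assms(1) by (simp add: adjoint_mat_mult hermitian_pd_matrix_inv[OF M] hermitian_mat_def
        matrix_mul_assoc)
  then have "adjoint_mat B *v z = 0"
    by (simp add: z_def matrix_vector_mul_assoc matrix_mul_assoc AMB)
  then have "cdot z (M *v z) = 0"
    by (simp add: Mz eq cdot_mult_right)
  then have "z = 0"
    by (rule hermitian_pd_kernel[OF M])
  with Mz show ?thesis by simp
qed

theorem mainTheorem11:
  fixes A M :: "complex ^ 'n ^ 'n"
    and B :: "complex ^ 'm ^ 'n"
    and U :: "complex ^ 'm ^ 'm"
    and F :: "complex ^ 'n"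
    and G :: "complex ^ 'm"
    and \<alpha>1 \<alpha>2 :: real
  assumes "hermitian_psd A"
    and "hermitian_pd M"
    and "A ** matrix_inv M ** B = 0"
    and "hermitian_pd U"
    and "G \<noteq> 0"
    and "G \<in> range ((*v) (adjoint_mat B))"
    and "vec.dim (C0 A B U) = 0"
    and "\<alpha>1 > 0" and "\<alpha>2 > 0" and "\<alpha>1 \<noteq> \<alpha>2"
  shows "(\<exists>!u. \<exists>p. A *v u + B *v p = F \<and> adjoint_mat B *v u = G) \<and>
    (\<exists>!u1. (A + \<alpha>1 *\<^sub>R (B ** U ** adjoint_mat B)) *v u1 = F + \<alpha>1 *\<^sub>R ((B ** U) *v G)) \<and>
    (\<exists>!u2. (A + \<alpha>2 *\<^sub>R (B ** U ** adjoint_mat B)) *v u2 = F + \<alpha>2 *\<^sub>R ((B ** U) *v G)) \<and>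
    (\<forall>u p u1 u2.
      A *v u + B *v p = F \<and> adjoint_mat B *v u = G \<and>
      (A + \<alpha>1 *\<^sub>R (B ** U ** adjoint_mat B)) *v u1 = F + \<alpha>1 *\<^sub>R ((B ** U) *v G) \<and>
      (A + \<alpha>2 *\<^sub>R (B ** U ** adjoint_mat B)) *v u2 = F + \<alpha>2 *\<^sub>R ((B ** U) *v G) \<longrightarrow>
      u = (\<alpha>1 *\<^sub>R u1 - \<alpha>2 *\<^sub>R u2) /\<^sub>R (\<alpha>1 - \<alpha>2))"
proof -
  define S where "S = B ** U ** adjoint_mat B"
  have S: "S *v x = B *v (U *v (adjoint_mat B *v x))" for x
    by (simp add: S_def matrix_vector_mul_assoc matrix_mul_assoc)
  have "hermitian_mat A"
    using assms(1) by (simp add: hermitian_psd_def)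
  note split = ranges_meet_trivially[OF this assms(2,3)]
  have ker: "x = 0" if "A *v x = 0" "S *v x = 0" for x
  proof -
    have "C0 A B U \<subseteq> {0}"
      using assms(7) by simp
    with that show ?thesis
      by (auto simp: C0_def ker_mat_def S_def)
  qed
  have kerS: "adjoint_mat B *v x = 0" if "S *v x = 0" for x
    using kernel_congruence[OF assms(4)] that by (simp add: S_def)
  have P: "(A + a *\<^sub>R S) *v x = A *v x + a *\<^sub>R (S *v x)" for a x
    by (simp add: matrix_vector_mult_add_rdistrib scaleR_matrix_vector_mult_complex)
  have bij: "bij ((*v) (A + a *\<^sub>R S))" if "a > 0" for a
  proof (rule square_matrix_bij_if_kernel_trivial)
    fix x assume "(A + a *\<^sub>R S) *v x = 0"
    then have eq: "A *v x = (- a) *\<^sub>R (S *v x)"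
      by (simp add: P eq_neg_iff_add_eq_0)
    \<comment> \<open>This puts A x in the range of \<open>B\<close>, so \<open>split\<close>
      annihilates it; since a is nonzero, S x vanishes too and \<open>ker\<close> applies.\<close>
    also have "\<dots> = B *v ((- a) *\<^sub>R (U *v (adjoint_mat B *v x)))"
      by (simp only: S matrix_vector_mult_scaleR_complex)
    finally have "A *v x = 0"
      by (rule split)
    with eq that show "x = 0"
      by (simp add: ker)
  qed
  have ex1: "\<exists>!x. (A + a *\<^sub>R S) *v x = y" if "a > 0" for a y
    using bij[OF that] by (simp add: bij_iff)
  obtain w where G: "G = adjoint_mat B *v w"
    using assms(6) by auto
  have BUG: "(B ** U) *v G = S *v w"
    by (simp add: G S matrix_vector_mul_assoc matrix_mul_assoc)
  \<comment> \<open>Surjectivity of A + S splits \<open>F\<close> into a part in the range of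
    \<open>A\<close> and a part in the range of \<open>B\<close>. The same \<open>f\<close> serves
    every parameter a.\<close>
  obtain f where "(A + 1 *\<^sub>R S) *v f = F"
    using ex1[of 1 F] by auto
  then have F: "F = A *v f + S *v f"
    using P[of 1 f] by simp
  have aug: "A *v x = A *v f \<and> a *\<^sub>R (S *v x) = S *v f + a *\<^sub>R (S *v w)"
    if "(A + a *\<^sub>R S) *v x = F + a *\<^sub>R ((B ** U) *v G)" for a x
  proof -
    have eq: "A *v x + a *\<^sub>R (S *v x) = A *v f + S *v f + a *\<^sub>R (S *v w)"
      using that by (simp add: P BUG F)
    \<comment> \<open>All \<open>A\<close> terms go to one side; the other side lies in the range of
      \<open>B\<close>, so both vanish and the equation separates.\<close>
    have "A *v (x - f) = S *v f + a *\<^sub>R (S *v w) - a *\<^sub>R (S *v x)"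
      using eq by (simp add: matrix_vector_mult_diff_distrib algebra_simps)
    also have "\<dots> = S *v (f + a *\<^sub>R w - a *\<^sub>R x)"
      by (simp add: matrix_vector_mult_diff_distrib matrix_vector_right_distrib
          matrix_vector_mult_scaleR_complex)
    also have "\<dots> = B *v (U *v (adjoint_mat B *v (f + a *\<^sub>R w - a *\<^sub>R x)))"
      by (rule S)
    finally have "A *v (x - f) = 0"
      by (rule split)
    then have "A *v x = A *v f"
      by (simp add: matrix_vector_mult_diff_distrib)
    with eq show ?thesis
      by (simp add: add.assoc)
  qed
  \<comment> \<open>The multipliers may differ: their difference only contributes a vector in the
    range of \<open>B\<close>, which \<open>split\<close> removes.\<close>
  have unique: "u = u'" if "A *v u + B *v p = F" "adjoint_mat B *v u = G"
    "A *v u' + B *v p' = F" "adjoint_mat B *v u' = G" for u p u' p'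
  proof -
    have "A *v (u - u') = B *v (p' - p)"
      using that(1,3) by (simp add: matrix_vector_mult_diff_distrib algebra_simps)
    then have "A *v (u - u') = 0"
      by (rule split)
    moreover have "S *v (u - u') = 0"
      using that(2,4) by (simp add: S matrix_vector_mult_diff_distrib)
    ultimately show ?thesis
      using ker by fastforce
  qed
  have extrapolated: "A *v u + B *v (U *v (adjoint_mat B *v f)) = F \<and> adjoint_mat B *v u = G"
    if u1: "(A + \<alpha>1 *\<^sub>R S) *v u1 = F + \<alpha>1 *\<^sub>R ((B ** U) *v G)"
      and u2: "(A + \<alpha>2 *\<^sub>R S) *v u2 = F + \<alpha>2 *\<^sub>R ((B ** U) *v G)"
      and u: "u = (\<alpha>1 *\<^sub>R u1 - \<alpha>2 *\<^sub>R u2) /\<^sub>R (\<alpha>1 - \<alpha>2)" for u u1 u2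
  proof -
    \<comment> \<open>Left general in \<open>X\<close> because it is applied to both
      \<open>A\<close> and \<open>S\<close>.\<close>
    have lin: "X *v u = (\<alpha>1 *\<^sub>R (X *v u1) - \<alpha>2 *\<^sub>R (X *v u2)) /\<^sub>R (\<alpha>1 - \<alpha>2)"
      for X :: "complex ^ 'n ^ 'n"
      by (simp only: u matrix_vector_mult_scaleR_complex matrix_vector_mult_diff_distrib)
    have cancel: "(\<alpha>1 *\<^sub>R v - \<alpha>2 *\<^sub>R v) /\<^sub>R (\<alpha>1 - \<alpha>2) = v" for v :: "complex ^ 'n"
      using assms(10) by (simp flip: scaleR_left_diff_distrib)
    have "A *v u = A *v f"
      using aug[OF u1] aug[OF u2] by (simp add: lin cancel)
    \<comment> \<open>By \<open>aug\<close>, both \<alpha>1 S u1 and \<alpha>2 S u2 contain the same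
      term S f, so it drops out of the difference and (\<alpha>1 - \<alpha>2) S w remains.\<close>
    moreover have "S *v u = S *v w"
      using aug[OF u1] aug[OF u2] by (simp add: lin cancel)
    then have "adjoint_mat B *v (u - w) = 0"
      using kerS[of "u - w"] by (simp add: matrix_vector_mult_diff_distrib)
    then have "adjoint_mat B *v u = G"
      by (simp add: G matrix_vector_mult_diff_distrib)
    ultimately show ?thesis
      by (simp add: F S)
  qed
  note aug1 = ex1[OF assms(8), of "F + \<alpha>1 *\<^sub>R ((B ** U) *v G)"]
  note aug2 = ex1[OF assms(9), of "F + \<alpha>2 *\<^sub>R ((B ** U) *v G)"]
  have "\<exists>!u. \<exists>p. A *v u + B *v p = F \<and> adjoint_mat B *v u = G"
  proof -
    obtain u1 u2 where
      "(A + \<alpha>1 *\<^sub>R S) *v u1 = F + \<alpha>1 *\<^sub>R ((B ** U) *v G)"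
      "(A + \<alpha>2 *\<^sub>R S) *v u2 = F + \<alpha>2 *\<^sub>R ((B ** U) *v G)"
      using aug1 aug2 by (elim ex1E)
    note sol = extrapolated[OF this refl]
    show ?thesis
    proof (rule ex1I, rule exI, rule sol)
      fix u assume "\<exists>p. A *v u + B *v p = F \<and> adjoint_mat B *v u = G"
      then obtain p where p: "A *v u + B *v p = F" "adjoint_mat B *v u = G"
        by (elim exE conjE)
      \<comment> \<open>The extrapolated vector, with multiplier U B* f, is itself a solution, so
        every other solution has the same u.\<close>
      from unique[OF p sol[THEN conjunct1] sol[THEN conjunct2]]
      show "u = (\<alpha>1 *\<^sub>R u1 - \<alpha>2 *\<^sub>R u2) /\<^sub>R (\<alpha>1 - \<alpha>2)" .
    qed
  qed
  moreover have "\<forall>u p u1 u2. A *v u + B *v p = F \<and> adjoint_mat B *v u = G \<and>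
      (A + \<alpha>1 *\<^sub>R S) *v u1 = F + \<alpha>1 *\<^sub>R ((B ** U) *v G) \<and>
      (A + \<alpha>2 *\<^sub>R S) *v u2 = F + \<alpha>2 *\<^sub>R ((B ** U) *v G) \<longrightarrow>
      u = (\<alpha>1 *\<^sub>R u1 - \<alpha>2 *\<^sub>R u2) /\<^sub>R (\<alpha>1 - \<alpha>2)"
  proof (intro allI impI, elim conjE)
    fix u p u1 u2
    assume u: "A *v u + B *v p = F" "adjoint_mat B *v u = G"
      and "(A + \<alpha>1 *\<^sub>R S) *v u1 = F + \<alpha>1 *\<^sub>R ((B ** U) *v G)"
        "(A + \<alpha>2 *\<^sub>R S) *v u2 = F + \<alpha>2 *\<^sub>R ((B ** U) *v G)"
    note sol = extrapolated[OF this(3,4) refl]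
    from unique[OF u sol[THEN conjunct1] sol[THEN conjunct2]]
    show "u = (\<alpha>1 *\<^sub>R u1 - \<alpha>2 *\<^sub>R u2) /\<^sub>R (\<alpha>1 - \<alpha>2)" .
  qed
  ultimately show ?thesis
    using aug1 aug2 unfolding S_def[symmetric] by (intro conjI)
qed

end
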